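(* For all integers $s\ge 2$ and $t\ge 1$, and every admissible ideal $J_{s,t}$ (as defined in the context), $$\operatorname{ara} J_{s,t}\le 2s+t-2.$$
   Context: Let $K$ be an algebraically closed field. For a reduced (radical) proper ideal $I$ of a polynomial ring $R$ over $K$, the arithmetical rank $\operatorname{ara} I$ is the least $r$ such that there are $F_1,\dots,F_r\in R$ with $I=\sqrt{(F_1,\dots,F_r)}$ (equivalently, the variety $V(I)$ is defined by the equations $F_1=\cdots=F_r=0$). For integers $s\ge2$, $t\ge1$, consider the two-row matrix $$A_{s,t}=\begin{pmatrix} x_1&x_2&\cdots&x_s& y_0& y_1&\cdots& y_{t-1}\\ x_{s+1}&x_{s+2}&\cdots&x_{2s}& z_1& z_2&\cdots& z_t\end{pmatrix},$$ where the entries $x_1,\dots,x_{2s},y_0,\dots,y_{t-1},z_1,\dots,z_t$ are indeterminates over $K$, assumed pairwise distinct with the following possible exceptions: one may have $x_{2s}=y_0$, or $z_i=y_j$ for some indices with $1\le i\le j\le t-1$, provided no entry appears more than twice in $A_{s,t}$. Let $R=K[x_1,\dots,x_{2s},y_0,\dots,y_{t-1},z_1,\dots,z_t]$ be the polynomial ring in the distinct entries. The ideal $J_{s,t}\subset R$ is generated by the union of: (I) the $2\times2$ minors of the submatrix formed by the first $s$ columns of $A_{s,t}$; (II) the products $x_iz_j$ with $1\le i\le s$, $1\le j\le t$; (III) the products $y_iz_j$ with $0\le i\le j-2\le t-2$. Thus $J_{s,t}$ denotes any ideal of the class obtained by varying the allowed identifications among the indeterminates, and statements about $J_{s,t}$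 hold for every such choice. *)

theory Defs
  imports
    "HOL-Algebra.Ideal"
    "HOL-Computational_Algebra.Polynomial"
    "HOL-Library.Poly_Mapping"
    "HOL-Library.Extended_Nat"
begin

text \<open>
  A polynomial is a finitely supported map from monomials to coefficients, and a monomial is a
  finitely supported map from indeterminates to exponents; the product on this type is the
  convolution product.
\<close>

type_synonym ('v, 'k) mpoly = "('v \<Rightarrow>\<^sub>0 nat) \<Rightarrow>\<^sub>0 'k"

definition Var :: "'v \<Rightarrow> ('v, 'k::comm_ring_1) mpoly" where
  "Var v = Poly_Mapping.single (Poly_Mapping.single v 1) 1"

text \<open>The polynomial ring over \<open>'k\<close> whose indeterminates are the elements of \<open>V\<close>.\<close>

definition mpoly_ring :: "'v set \<Rightarrow> ('v, 'k::comm_ring_1) mpoly ring" where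
  "mpoly_ring V =
     \<lparr>carrier = {p. \<forall>m \<in> Poly_Mapping.keys p. Poly_Mapping.keys m \<subseteq> V},
      monoid.mult = (*), one = 1, zero = 0, add = (+)\<rparr>"

lemma mpoly_ring_cring:
  "cring (mpoly_ring V :: ('v, 'k::comm_ring_1) mpoly ring)" (is "cring ?R")
proof (rule cringI)
  show "abelian_group ?R"
  proof (rule abelian_groupI)
    fix p assume "p \<in> carrier ?R"
    then show "\<exists>q \<in> carrier ?R. q \<oplus>\<^bsub>?R\<^esub> p = \<zero>\<^bsub>?R\<^esub>"
      by (intro bexI[of _ "- p"]) (auto simp: mpoly_ring_def)
  qed (use Poly_Mapping.keys_add in \<open>fastforce simp: mpoly_ring_def algebra_simps\<close>)+
  show "comm_monoid ?R"
  proof (rule comm_monoidI)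
    fix p q assume *: "p \<in> carrier ?R" "q \<in> carrier ?R"
    have "Poly_Mapping.keys m \<subseteq> V" if "m \<in> Poly_Mapping.keys (p * q)" for m
    proof -
      from that keys_mult[of p q] obtain a b where
        "m = a + b" "a \<in> Poly_Mapping.keys p" "b \<in> Poly_Mapping.keys q" by blast
      with * keys_add[of a b] show ?thesis by (fastforce simp: mpoly_ring_def)
    qed
    then show "p \<otimes>\<^bsub>?R\<^esub> q \<in> carrier ?R" by (simp add: mpoly_ring_def)
  qed (auto simp: mpoly_ring_def algebra_simps)
qed (simp add: mpoly_ring_def algebra_simps)

definition radical_ideal :: "('a, 'b) ring_scheme \<Rightarrow> 'a set \<Rightarrow> 'a set" where
  "radical_ideal R I = {f \<in> carrier R. \<exists>n::nat. f [^]\<^bsub>R\<^esub> n \<in> I}"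

text \<open>
  The infimum is taken in \<^typ>\<open>enat\<close>, so it is \<open>\<infinity>\<close> if \<open>I\<close> is not the radical of a finitely
  generated ideal; otherwise it is attained. The radical is not applied to \<open>I\<close> itself.
\<close>

definition ara :: "('a, 'b) ring_scheme \<Rightarrow> 'a set \<Rightarrow> enat" where
  "ara R I = (INF r \<in> {r. \<exists>F :: nat \<Rightarrow> 'a. F ` {1..r} \<subseteq> carrier R \<and>
                              I = radical_ideal R (Idl\<^bsub>R\<^esub> (F ` {1..r}))}. enat r)"

text \<open>
  The \<open>2 \<times> (s + t)\<close> matrix of indeterminates, with rows and columns numbered from 1. The first
  \<open>s\<close> columns are \<open>(x\<^sub>c, x\<^sub>s\<^sub>+\<^sub>c)\<close>, and column \<open>s + j\<close> is \<open>(y\<^sub>j\<^sub>-\<^sub>1, z\<^sub>j)\<close> for \<open>1 \<le> j \<le> t\<close>. The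
  families \<open>x\<close>, \<open>y\<close>, \<open>z\<close> name indeterminates, so that identifying two entries means that these
  maps take a common value; their values at other indices play no role.
\<close>

definition matA ::
  "nat \<Rightarrow> (nat \<Rightarrow> 'v) \<Rightarrow> (nat \<Rightarrow> 'v) \<Rightarrow> (nat \<Rightarrow> 'v) \<Rightarrow> nat \<Rightarrow> nat \<Rightarrow> 'v" where
  "matA s x y z r c =
     (if r = 1 then (if c \<le> s then x c else y (c - s - 1))
      else (if c \<le> s then x (s + c) else z (c - s)))"

definition positions :: "nat \<Rightarrow> nat \<Rightarrow> (nat \<times> nat) set" where
  "positions s t = {1, 2} \<times> {1..s + t}"

definition entries ::
  "nat \<Rightarrow> nat \<Rightarrow> (nat \<Rightarrow> 'v) \<Rightarrow> (nat \<Rightarrow> 'v) \<Rightarrow> (nat \<Rightarrow> 'v) \<Rightarrow> 'v set" where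
  "entries s t x y z = (\<lambda>(r, c). matA s x y z r c) ` positions s t"

definition admissible ::
  "nat \<Rightarrow> nat \<Rightarrow> (nat \<Rightarrow> 'v) \<Rightarrow> (nat \<Rightarrow> 'v) \<Rightarrow> (nat \<Rightarrow> 'v) \<Rightarrow> bool" where
  "admissible s t x y z \<longleftrightarrow>
     inj_on x {1..2 * s} \<and> inj_on y {0..t - 1} \<and> inj_on z {1..t} \<and>
     (\<forall>i \<in> {1..2 * s}. \<forall>j \<in> {0..t - 1}. x i = y j \<longrightarrow> i = 2 * s \<and> j = 0) \<and>
     (\<forall>i \<in> {1..2 * s}. \<forall>j \<in> {1..t}. x i \<noteq> z j) \<and>
     (\<forall>i \<in> {1..t}. \<forall>j \<in> {0..t - 1}. z i = y j \<longrightarrow> i \<le> j) \<and>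
     (\<forall>v. card {(r, c). (r, c) \<in> positions s t \<and> matA s x y z r c = v} \<le> 2)"

definition J_gens ::
  "nat \<Rightarrow> nat \<Rightarrow> (nat \<Rightarrow> 'v) \<Rightarrow> (nat \<Rightarrow> 'v) \<Rightarrow> (nat \<Rightarrow> 'v) \<Rightarrow> ('v, 'k::comm_ring_1) mpoly set" where
  "J_gens s t x y z =
     {Var (matA s x y z 1 i) * Var (matA s x y z 2 j)
        - Var (matA s x y z 1 j) * Var (matA s x y z 2 i) | i j. 1 \<le> i \<and> i < j \<and> j \<le> s}
     \<union> {Var (x i) * Var (z j) | i j. 1 \<le> i \<and> i \<le> s \<and> 1 \<le> j \<and> j \<le> t}
     \<union> {Var (y i) * Var (z j) | i j. i + 2 \<le> j \<and> j \<le> t}"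

definition J_ideal ::
  "nat \<Rightarrow> nat \<Rightarrow> (nat \<Rightarrow> 'v) \<Rightarrow> (nat \<Rightarrow> 'v) \<Rightarrow> (nat \<Rightarrow> 'v) \<Rightarrow> ('v, 'k::comm_ring_1) mpoly set" where
  "J_ideal s t x y z = Idl\<^bsub>mpoly_ring (entries s t x y z)\<^esub> (J_gens s t x y z)"

end

theory Submission
  imports Defs
begin

text \<open>
  Two things are needed: polynomials \<open>F 1, \<dots>, F (2 * s + t - 2)\<close> in \<open>J\<close> whose radical contains the
  generators of \<open>J\<close>, and the fact that \<open>J\<close> is a radical ideal.

  The polynomials are sums of generators, as in the lemma of Schmitt and Vogel (\<open>schmitt_vogel\<close>).
  The generators are indexed by pairs of columns \<open>a < b\<close> of the matrix: minors for \<open>b \<le> s\<close>, and the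
  product of the upper entry of column \<open>a\<close> and the lower entry of column \<open>b\<close> for \<open>b > s\<close>. Each pair
  gets a level in \<open>{1..2 * s + t - 2}\<close>, and \<open>F l\<close> is the sum of the generators of level \<open>l\<close>. The lemma
  applies because the product of two generators of equal level is in the ideal of the generators of
  lower levels (\<open>generator_products_lower_level\<close>). For minors alone, levels by column sum would give
  \<open>2 * s - 3\<close> sums, by the Pluecker relations; for products alone, levels by distance of columns would
  give \<open>s + t - 1\<close> sums. The bound comes from letting \<open>s - 2\<close> of these coincide: a product with a
  close pair of columns can be added to a minor of small column sum, since multiplying the two yields
  products whose columns are farther apart.

  That \<open>J\<close> is radical (\<open>J_ideal_radical\<close>) follows from the decomposition of \<open>J\<close> as the intersection
  of the ideal of the minors and all \<open>z j\<close> with the ideal of \<open>x 1, \<dots>, x s\<close> and the products of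
  type (III). The first is prime, as it comes from the parametrisation of matrices of rank one, and
  the second is generated by squarefree monomials. Both facts are used through monomial curves, that
  is, substitutions of powers of one variable (or of \<open>0\<close>) for the indeterminates: if a power of \<open>p\<close> is in
  \<open>J\<close>, then \<open>p\<close> vanishes on every monomial curve in the variety of \<open>J\<close>, and with weights that separate
  the monomials of \<open>p\<close> as far as possible this forces \<open>p\<close> to be in \<open>J\<close>.
\<close>

section \<open>Ideals and radicals in the polynomial ring\<close>

lemma mpoly_ring_simps [simp]:
  "x \<otimes>\<^bsub>mpoly_ring V\<^esub> y = x * y" "x \<oplus>\<^bsub>mpoly_ring V\<^esub> y = x + y"
  "\<one>\<^bsub>mpoly_ring V\<^esub> = 1" "\<zero>\<^bsub>mpoly_ring V\<^esub> = 0"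
  by (simp_all add: mpoly_ring_def)

lemma mpoly_ring_carrier_iff:
  "p \<in> carrier (mpoly_ring V) \<longleftrightarrow> (\<forall>m \<in> Poly_Mapping.keys p. Poly_Mapping.keys m \<subseteq> V)"
  by (simp add: mpoly_ring_def)

lemma mpoly_ring_pow [simp]: "p [^]\<^bsub>mpoly_ring V\<^esub> (n::nat) = p ^ n"
  by (induction n) (simp_all add: mult.commute)

lemma mpoly_ring_closed:
  fixes p q :: "('v, 'k::comm_ring_1) mpoly"
  shows "0 \<in> carrier (mpoly_ring V :: ('v, 'k) mpoly ring)"
    "1 \<in> carrier (mpoly_ring V :: ('v, 'k) mpoly ring)"
    "p \<in> carrier (mpoly_ring V) \<Longrightarrow> q \<in> carrier (mpoly_ring V) \<Longrightarrow> p + q \<in> carrier (mpoly_ring V)"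
    "p \<in> carrier (mpoly_ring V) \<Longrightarrow> q \<in> carrier (mpoly_ring V) \<Longrightarrow> p * q \<in> carrier (mpoly_ring V)"
    "p \<in> carrier (mpoly_ring V) \<Longrightarrow> - p \<in> carrier (mpoly_ring V)"
    "p \<in> carrier (mpoly_ring V) \<Longrightarrow> q \<in> carrier (mpoly_ring V) \<Longrightarrow> p - q \<in> carrier (mpoly_ring V)"
proof -
  interpret cring "mpoly_ring V :: ('v, 'k) mpoly ring" by (rule mpoly_ring_cring)
  show "0 \<in> carrier (mpoly_ring V :: ('v, 'k) mpoly ring)"
    "1 \<in> carrier (mpoly_ring V :: ('v, 'k) mpoly ring)"
    using zero_closed one_closed by simp_all
  show add: "p \<in> carrier (mpoly_ring V) \<Longrightarrow> q \<in> carrier (mpoly_ring V) \<Longrightarrow> p + q \<in> carrier (mpoly_ring V)" for p q :: "('v, 'k) mpoly"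
    using a_closed[of p q] by simp
  show "p \<in> carrier (mpoly_ring V) \<Longrightarrow> q \<in> carrier (mpoly_ring V) \<Longrightarrow> p * q \<in> carrier (mpoly_ring V)"
    using m_closed[of p q] by simp
  show neg: "p \<in> carrier (mpoly_ring V) \<Longrightarrow> - p \<in> carrier (mpoly_ring V)" for p :: "('v, 'k) mpoly"
    by (simp add: mpoly_ring_carrier_iff)
  show "p \<in> carrier (mpoly_ring V) \<Longrightarrow> q \<in> carrier (mpoly_ring V) \<Longrightarrow> p - q \<in> carrier (mpoly_ring V)"
    using add[of p "- q"] neg[of q] by simp
qed

lemma mpoly_ring_pow_closed:
  "p \<in> carrier (mpoly_ring V) \<Longrightarrow> p ^ n \<in> carrier (mpoly_ring V)"
  by (induction n) (auto intro: mpoly_ring_closed)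

lemma mpoly_ring_of_nat_closed: "of_nat n \<in> carrier (mpoly_ring V)"
  by (induction n) (auto intro: mpoly_ring_closed)

lemma mpoly_ring_sum_closed:
  "(\<And>i. i \<in> A \<Longrightarrow> f i \<in> carrier (mpoly_ring V)) \<Longrightarrow> sum f A \<in> carrier (mpoly_ring V)"
  by (induction A rule: infinite_finite_induct) (auto intro: mpoly_ring_closed)

lemma Var_closed: "v \<in> V \<Longrightarrow> Var v \<in> carrier (mpoly_ring V)"
  by (simp add: Var_def mpoly_ring_carrier_iff)

lemma mpoly_ideal_closed:
  assumes "ideal I (mpoly_ring V)"
  shows mpoly_ideal_carrier: "p \<in> I \<Longrightarrow> p \<in> carrier (mpoly_ring V)"
    and mpoly_ideal_zero: "0 \<in> I"
    and mpoly_ideal_add: "p \<in> I \<Longrightarrow> q \<in> I \<Longrightarrow> p + q \<in> I"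
    and mpoly_ideal_mult: "p \<in> I \<Longrightarrow> c \<in> carrier (mpoly_ring V) \<Longrightarrow> c * p \<in> I"
proof -
  interpret ideal I "mpoly_ring V" by fact
  show "p \<in> I \<Longrightarrow> p \<in> carrier (mpoly_ring V)" by (rule Icarr)
  show "0 \<in> I" using additive_subgroup.zero_closed[OF additive_subgroup_axioms] by simp
  show "p \<in> I \<Longrightarrow> q \<in> I \<Longrightarrow> p + q \<in> I"
    using additive_subgroup.a_closed[OF additive_subgroup_axioms, of p q] by simp
  show "p \<in> I \<Longrightarrow> c \<in> carrier (mpoly_ring V) \<Longrightarrow> c * p \<in> I"
    using I_l_closed[of p c] by simp
qed

lemma mpoly_ideal_diff:
  assumes "ideal I (mpoly_ring V)" "p \<in> I" "q \<in> I"
  shows "p - q \<in> I"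
  using mpoly_ideal_add[OF assms(1,2), of "- q"] mpoly_ideal_mult[OF assms(1,3), of "-1"]
  by (simp add: mpoly_ring_closed)

lemma mpoly_ideal_sum:
  assumes "ideal I (mpoly_ring V)" "\<And>i. i \<in> A \<Longrightarrow> f i \<in> I"
  shows "sum f A \<in> I"
  using assms(2) mpoly_ideal_zero[OF assms(1)] mpoly_ideal_add[OF assms(1)]
  by (induction A rule: infinite_finite_induct) auto

lemma mpoly_idealI:
  fixes V :: "'v set" and I :: "('v, 'k::comm_ring_1) mpoly set"
  assumes "I \<subseteq> carrier (mpoly_ring V)" "0 \<in> I" "\<And>p q. p \<in> I \<Longrightarrow> q \<in> I \<Longrightarrow> p + q \<in> I"
    and mult: "\<And>c p. c \<in> carrier (mpoly_ring V) \<Longrightarrow> p \<in> I \<Longrightarrow> c * p \<in> I"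
  shows "ideal I (mpoly_ring V)"
proof -
  interpret cring "mpoly_ring V :: ('v, 'k) mpoly ring" by (rule mpoly_ring_cring)
  show ?thesis
  proof (rule idealI)
    show "subgroup I (add_monoid (mpoly_ring V))"
    proof (rule add.subgroupI)
      fix p assume p: "p \<in> I"
      then have "p \<in> carrier (mpoly_ring V)" using assms(1) by blast
      then have "\<ominus>\<^bsub>mpoly_ring V\<^esub> p = (-1) * p"
        by (intro minus_equality) (simp_all add: mpoly_ring_closed)
      with p mult[of "-1" p] show "\<ominus>\<^bsub>mpoly_ring V\<^esub> p \<in> I"
        by (simp add: mpoly_ring_closed)
    qed (use assms in auto)
  next
    fix a x :: "('v, 'k) mpoly" assume "a \<in> I" "x \<in> carrier (mpoly_ring V)"
    then show "x \<otimes>\<^bsub>mpoly_ring V\<^esub> a \<in> I" "a \<otimes>\<^bsub>mpoly_ring V\<^esub> x \<in> I"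
      using mult[of x a] by (simp_all add: mult.commute)
  qed (rule ring_axioms)
qed

text \<open>
  In the binomial expansion of \<open>(p + q) ^ (n + m)\<close> each term is divisible by \<open>p ^ n\<close> or by \<open>q ^ m\<close>.
\<close>

lemma ideal_radical_ideal:
  fixes V :: "'v set" and I :: "('v, 'k::comm_ring_1) mpoly set"
  assumes I: "ideal I (mpoly_ring V)"
  shows "ideal (radical_ideal (mpoly_ring V) I) (mpoly_ring V)"
proof (rule mpoly_idealI)
  fix p q assume "p \<in> radical_ideal (mpoly_ring V) I" "q \<in> radical_ideal (mpoly_ring V) I"
  then obtain n m where p: "p \<in> carrier (mpoly_ring V)" "p ^ n \<in> I"
    and q: "q \<in> carrier (mpoly_ring V)" "q ^ m \<in> I"
    by (auto simp: radical_ideal_def)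
  have "(p + q) ^ (n + m) = (\<Sum>k\<le>n + m. of_nat (n + m choose k) * p ^ k * q ^ (n + m - k))"
    by (rule binomial_ring)
  also have "\<dots> \<in> I"
  proof (rule mpoly_ideal_sum[OF I])
    fix k assume k: "k \<in> {..n + m}"
    show "of_nat (n + m choose k) * p ^ k * q ^ (n + m - k) \<in> I"
    proof (cases "n \<le> k")
      case True
      then have "p ^ k = p ^ (k - n) * p ^ n"
        by (simp flip: power_add)
      then have "of_nat (n + m choose k) * p ^ k * q ^ (n + m - k) =
          (of_nat (n + m choose k) * q ^ (n + m - k) * p ^ (k - n)) * p ^ n"
        by (simp add: ac_simps)
      then show ?thesis
        using p q by (auto intro!: mpoly_ideal_mult[OF I] mpoly_ring_closed mpoly_ring_pow_closed
            mpoly_ring_of_nat_closed)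
    next
      case False
      then have "q ^ (n + m - k) = q ^ (n - k) * q ^ m"
        by (simp flip: power_add)
      then have "of_nat (n + m choose k) * p ^ k * q ^ (n + m - k) =
          (of_nat (n + m choose k) * p ^ k * q ^ (n - k)) * q ^ m"
        by (simp add: ac_simps)
      then show ?thesis
        using p q by (auto intro!: mpoly_ideal_mult[OF I] mpoly_ring_closed mpoly_ring_pow_closed
            mpoly_ring_of_nat_closed)
    qed
  qed
  finally show "p + q \<in> radical_ideal (mpoly_ring V) I"
    using p q by (auto simp: radical_ideal_def intro: mpoly_ring_closed)
next
  fix c p :: "('v, 'k) mpoly" assume c: "c \<in> carrier (mpoly_ring V)" and "p \<in> radical_ideal (mpoly_ring V) I"
  then show "c * p \<in> radical_ideal (mpoly_ring V) I"
    by (auto simp: radical_ideal_def power_mult_distrib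
        intro!: mpoly_ring_closed mpoly_ideal_mult[OF I] mpoly_ring_pow_closed)
next
  show "0 \<in> radical_ideal (mpoly_ring V) I"
    by (auto simp: radical_ideal_def mpoly_ring_closed mpoly_ideal_zero[OF I] intro!: exI[of _ 1])
qed (auto simp: radical_ideal_def)

lemma subset_radical_ideal:
  assumes "ideal I (mpoly_ring V)"
  shows "I \<subseteq> radical_ideal (mpoly_ring V) I"
  by (auto simp: radical_ideal_def mpoly_ideal_carrier[OF assms] intro!: exI[of _ 1])

lemma radical_ideal_square:
  assumes "p \<in> carrier (mpoly_ring V)" "p * p \<in> radical_ideal (mpoly_ring V) I"
  shows "p \<in> radical_ideal (mpoly_ring V) I"
  using assms by (auto simp: radical_ideal_def simp flip: power2_eq_square power_mult)

section \<open>The lemma of Schmitt and Vogel\<close>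

text \<open>
  The elements of one level may be replaced by their sum, up to radicals. By induction on the level,
  all elements of lower levels lie in the radical \<open>T\<close>. Multiplying the sum of the level of \<open>p\<close> by
  \<open>e p\<close> then leaves only the square of \<open>e p\<close> modulo \<open>T\<close>, so that \<open>e p\<close> itself is in \<open>T\<close>.
\<close>

theorem schmitt_vogel:
  fixes V :: "'v set" and e :: "'i \<Rightarrow> ('v, 'k::comm_ring_1) mpoly" and level :: "'i \<Rightarrow> nat"
  defines "R \<equiv> mpoly_ring V :: ('v, 'k) mpoly ring"
  assumes fin: "finite P" and e: "e ` P \<subseteq> carrier R"
    and level: "level ` P \<subseteq> L"
    and lower: "\<And>p q. p \<in> P \<Longrightarrow> q \<in> P \<Longrightarrow> p \<noteq> q \<Longrightarrow> level p = level q \<Longrightarrow>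
      e p * e q \<in> Idl\<^bsub>R\<^esub> (e ` {i \<in> P. level i < level p})"
  shows "e ` P \<subseteq> radical_ideal R (Idl\<^bsub>R\<^esub> ((\<lambda>l. \<Sum>i | i \<in> P \<and> level i = l. e i) ` L))"
proof -
  define F where "F = (\<lambda>l. \<Sum>i | i \<in> P \<and> level i = l. e i)"
  define T where "T = radical_ideal R (Idl\<^bsub>R\<^esub> (F ` L))"
  interpret cring R unfolding R_def by (rule mpoly_ring_cring)
  have F: "F ` L \<subseteq> carrier R"
    using e by (auto simp: F_def R_def intro!: mpoly_ring_sum_closed)
  have I: "ideal (Idl\<^bsub>R\<^esub> (F ` L)) R" by (rule genideal_ideal[OF F])
  then have T: "ideal T R" unfolding T_def R_def by (intro ideal_radical_ideal)
  note cl = mpoly_ideal_closed[OF T[unfolded R_def]] mpoly_ideal_diff[OF T[unfolded R_def]]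
    mpoly_ideal_sum[OF T[unfolded R_def]]
  have "e p \<in> T" if "p \<in> P" for p
    using that
  proof (induction "level p" arbitrary: p rule: less_induct)
    case less
    have low: "Idl\<^bsub>R\<^esub> (e ` {i \<in> P. level i < level p}) \<subseteq> T"
      using less.hyps by (intro genideal_minimal[OF T]) auto
    let ?Q = "{i \<in> P. level i = level p}"
    have ep: "e p \<in> carrier (mpoly_ring V)" using e less.prems by (auto simp: R_def)
    have "F (level p) \<in> T"
      using less.prems level genideal_self[OF F] subset_radical_ideal[OF I[unfolded R_def]]
      unfolding T_def R_def by blast
    then have a: "e p * F (level p) \<in> T" using cl(4) ep by blast
    have b: "(\<Sum>q \<in> ?Q - {p}. e p * e q) \<in> T"
    proof (rule cl(6))
      fix q assume "q \<in> ?Q - {p}"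
      with lower[of p q] less.prems low show "e p * e q \<in> T" by auto
    qed
    have "e p * F (level p) = (\<Sum>q \<in> ?Q. e p * e q)" by (simp add: F_def sum_distrib_left)
    also have "\<dots> = e p * e p + (\<Sum>q \<in> ?Q - {p}. e p * e q)"
      using fin less.prems by (subst sum.remove[of _ p]) auto
    finally have "e p * e p = e p * F (level p) - (\<Sum>q \<in> ?Q - {p}. e p * e q)" by simp
    then have "e p * e p \<in> T" using cl(5)[OF a b] by simp
    then show ?case using ep unfolding T_def R_def by (rule radical_ideal_square[rotated])
  qed
  then have "e ` P \<subseteq> T" by blast
  then show ?thesis by (simp only: T_def F_def)
qed

section \<open>Substituting powers of one variable\<close>

definition weight :: "('v \<Rightarrow> nat) \<Rightarrow> ('v \<Rightarrow>\<^sub>0 nat) \<Rightarrow> nat" where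
  "weight w m = (\<Sum>v \<in> Poly_Mapping.keys m. Poly_Mapping.lookup m v * w v)"

text \<open>
  The homomorphism to polynomials in one variable \<open>X\<close> that substitutes \<open>X ^ w v\<close> for each
  indeterminate \<open>v \<in> W\<close> and \<open>0\<close> for all others: the restriction of \<open>p\<close> to a monomial curve. Over a
  domain its values lie in a domain, whatever the type of indeterminates; it serves to show that powers of a
  polynomial do not vanish where the polynomial does not.
\<close>

definition curve :: "('v \<Rightarrow> nat) \<Rightarrow> 'v set \<Rightarrow> ('v, 'k::comm_ring_1) mpoly \<Rightarrow> 'k poly" where
  "curve w W p = (\<Sum>m | m \<in> Poly_Mapping.keys p \<and> Poly_Mapping.keys m \<subseteq> W.
     monom (Poly_Mapping.lookup p m) (weight w m))"

lemma weight_superset: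
  assumes "finite V" "Poly_Mapping.keys m \<subseteq> V"
  shows "weight w m = (\<Sum>v \<in> V. Poly_Mapping.lookup m v * w v)"
  unfolding weight_def using assms
  by (intro sum.mono_neutral_left) (auto simp: in_keys_iff)

lemma weight_add: "weight w (a + b) = weight w a + weight w b"
proof -
  let ?V = "Poly_Mapping.keys a \<union> Poly_Mapping.keys b"
  have "finite ?V" "Poly_Mapping.keys (a + b) \<subseteq> ?V" using keys_add[of a b] by auto
  then show ?thesis
    by (simp add: weight_superset[of ?V] lookup_add distrib_right sum.distrib)
qed

lemma weight_single: "weight w (Poly_Mapping.single v n) = n * w v"
  by (simp add: weight_def)

lemma keys_add_nat:
  fixes a b :: "'v \<Rightarrow>\<^sub>0 nat"
  shows "Poly_Mapping.keys (a + b) = Poly_Mapping.keys a \<union> Poly_Mapping.keys b"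
  by (auto simp: in_keys_iff lookup_add)

lemma curve_superset:
  assumes "finite M" "Poly_Mapping.keys p \<subseteq> M"
  shows "curve w W p = (\<Sum>m \<in> M. if Poly_Mapping.keys m \<subseteq> W
    then monom (Poly_Mapping.lookup p m) (weight w m) else 0)"
proof -
  have "curve w W p = (\<Sum>m \<in> Poly_Mapping.keys p. if Poly_Mapping.keys m \<subseteq> W
    then monom (Poly_Mapping.lookup p m) (weight w m) else 0)"
    unfolding curve_def by (simp add: sum.inter_filter)
  also have "\<dots> = (\<Sum>m \<in> M. if Poly_Mapping.keys m \<subseteq> W
    then monom (Poly_Mapping.lookup p m) (weight w m) else 0)"
    using assms by (intro sum.mono_neutral_left) (auto simp: in_keys_iff)
  finally show ?thesis .
qed

lemma curve_zero [simp]: "curve w W 0 = 0"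
  by (simp add: curve_def)

lemma curve_add: "curve w W (p + q) = curve w W p + curve w W q"
proof -
  let ?M = "Poly_Mapping.keys p \<union> Poly_Mapping.keys q"
  have "finite ?M" "Poly_Mapping.keys (p + q) \<subseteq> ?M" using keys_add[of p q] by auto
  then show ?thesis
    by (auto simp: curve_superset[of ?M] lookup_add add_monom simp flip: sum.distrib intro!: sum.cong)
qed

lemma curve_sum: "curve w W (sum f A) = (\<Sum>i \<in> A. curve w W (f i))"
  by (induction A rule: infinite_finite_induct) (auto simp: curve_add)

lemma curve_single:
  "curve w W (Poly_Mapping.single m c) = (if Poly_Mapping.keys m \<subseteq> W then monom c (weight w m) else 0)"
  by (subst curve_superset[of "{m}"]) auto

lemma coeff_curve:
  "coeff (curve w W p) n = (\<Sum>m | m \<in> Poly_Mapping.keys p \<and> Poly_Mapping.keys m \<subseteq> W \<and>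
     weight w m = n. Poly_Mapping.lookup p m)"
proof -
  have "coeff (curve w W p) n = (\<Sum>m | m \<in> Poly_Mapping.keys p \<and> Poly_Mapping.keys m \<subseteq> W.
      if weight w m = n then Poly_Mapping.lookup p m else 0)"
    by (simp add: curve_def coeff_sum)
  also have "\<dots> = (\<Sum>m | m \<in> Poly_Mapping.keys p \<and> Poly_Mapping.keys m \<subseteq> W \<and>
      weight w m = n. Poly_Mapping.lookup p m)"
    by (intro sum.mono_neutral_cong_right) auto
  finally show ?thesis .
qed

lemma mpoly_eq_sum_single:
  "p = (\<Sum>m \<in> Poly_Mapping.keys p. Poly_Mapping.single m (Poly_Mapping.lookup p m))"
  by (rule poly_mapping_eqI) (simp add: lookup_sum lookup_single when_def in_keys_iff)

lemma curve_mult: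
  fixes p q :: "('v, 'k::comm_ring_1) mpoly"
  shows "curve w W (p * q) = curve w W p * curve w W q"
proof -
  define f where "f p m = Poly_Mapping.single m (Poly_Mapping.lookup p m)" for p :: "('v, 'k) mpoly" and m
  have "p = sum (f p) (Poly_Mapping.keys p)" "q = sum (f q) (Poly_Mapping.keys q)"
    unfolding f_def by (rule mpoly_eq_sum_single)+
  moreover have "curve w W (sum (f p) A * sum (f q) B) = curve w W (sum (f p) A) * curve w W (sum (f q) B)" for A B
    by (auto simp: sum_product curve_sum f_def mult_single curve_single weight_add keys_add_nat mult_monom
        intro!: sum.cong)
  ultimately show ?thesis by metis
qed

lemma curve_pow: "curve w W (p ^ Suc n) = curve w W p ^ Suc n"
  by (induction n) (simp_all add: curve_mult)

lemma curve_diff: "curve w W (p - q) = curve w W p - curve w W q"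
  using curve_add[of w W "p - q" q] by (simp add: algebra_simps)

lemma curve_Var: "curve w W (Var v) = (if v \<in> W then monom 1 (w v) else 0)"
  by (simp add: Var_def curve_single weight_single)

lemma curve_vanishes_on_ideal:
  assumes "G \<subseteq> carrier (mpoly_ring V)" "\<And>g. g \<in> G \<Longrightarrow> curve w W g = 0"
    and "p \<in> Idl\<^bsub>mpoly_ring V\<^esub> G"
  shows "curve w W p = 0"
proof -
  interpret cring "mpoly_ring V :: ('a, 'b) mpoly ring" by (rule mpoly_ring_cring)
  have "ideal {p \<in> carrier (mpoly_ring V). curve w W p = 0} (mpoly_ring V)"
    by (rule mpoly_idealI) (auto simp: curve_add curve_mult mpoly_ring_closed)
  then have "Idl\<^bsub>mpoly_ring V\<^esub> G \<subseteq> {p \<in> carrier (mpoly_ring V). curve w W p = 0}"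
    using assms(1,2) by (intro genideal_minimal) auto
  with assms(3) show ?thesis by blast
qed

lemma curve_vanishes_if_power:
  fixes p :: "('v, 'k::idom) mpoly"
  assumes "curve w W (p ^ n) = 0"
  shows "curve w W p = 0"
proof (cases n)
  case 0
  then show ?thesis using assms curve_mult[of w W 1 p] by simp
next
  case (Suc k)
  then show ?thesis using assms by (simp only: curve_pow power_eq_0_iff)
qed

text \<open>
  Modulo \<open>I\<close>, the monomials that survive on the curve may be replaced by one representative for each
  weight. The representative of weight \<open>n\<close> then gets the coefficient of \<open>X ^ n\<close> in \<open>curve w W p\<close>, which
  is zero. The monomials that do not survive are in \<open>I\<close> by assumption.
\<close>

lemma mem_ideal_if_curve_vanishes:
  fixes p :: "('v, 'k::comm_ring_1) mpoly"
  assumes I: "ideal I (mpoly_ring V)" and p: "p \<in> carrier (mpoly_ring V)" and 0: "curve w W p = 0"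
    and out: "\<And>m. m \<in> Poly_Mapping.keys p \<Longrightarrow> \<not> Poly_Mapping.keys m \<subseteq> W \<Longrightarrow> Poly_Mapping.single m 1 \<in> I"
    and eq: "\<And>m m'. m \<in> Poly_Mapping.keys p \<Longrightarrow> m' \<in> Poly_Mapping.keys p \<Longrightarrow>
      Poly_Mapping.keys m \<subseteq> W \<Longrightarrow> Poly_Mapping.keys m' \<subseteq> W \<Longrightarrow> weight w m = weight w m' \<Longrightarrow>
      Poly_Mapping.single m 1 - Poly_Mapping.single m' 1 \<in> I"
  shows "p \<in> I"
proof -
  define M where "M = {m \<in> Poly_Mapping.keys p. Poly_Mapping.keys m \<subseteq> W}"
  define c where "c m = Poly_Mapping.single (0 :: 'v \<Rightarrow>\<^sub>0 nat) (Poly_Mapping.lookup p m)" for m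
  define mon where "mon m = (Poly_Mapping.single m 1 :: ('v, 'k) mpoly)" for m
  define rep where "rep n = (SOME m. m \<in> M \<and> weight w m = n)" for n
  have rep: "rep (weight w m) \<in> M \<and> weight w (rep (weight w m)) = weight w m" if "m \<in> M" for m
    unfolding rep_def by (rule someI[of _ m]) (use that in simp)
  have fin: "finite M" by (simp add: M_def)
  have c: "c m \<in> carrier (mpoly_ring V)" for m by (simp add: c_def mpoly_ring_carrier_iff)
  have zero: "(\<Sum>m | m \<in> M \<and> weight w m = n. c m) = 0" for n
  proof -
    have "(\<Sum>m | m \<in> M \<and> weight w m = n. Poly_Mapping.lookup p m) = coeff (curve w W p) n"
      by (simp add: coeff_curve M_def conj_assoc)
    with 0 have *: "(\<Sum>m | m \<in> M \<and> weight w m = n. Poly_Mapping.lookup p m) = 0" by simp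
    show ?thesis
    proof (rule poly_mapping_eqI)
      fix k show "Poly_Mapping.lookup (\<Sum>m | m \<in> M \<and> weight w m = n. c m) k = Poly_Mapping.lookup 0 k"
        using * by (cases "k = 0") (simp_all add: lookup_sum c_def lookup_single)
    qed
  qed
  have "p = (\<Sum>m \<in> Poly_Mapping.keys p. c m * mon m)"
    using mpoly_eq_sum_single[of p] by (simp add: c_def mon_def mult_single)
  also have "\<dots> = (\<Sum>m \<in> Poly_Mapping.keys p - M. c m * mon m) + (\<Sum>m \<in> M. c m * mon m)"
    by (rule sum.subset_diff) (auto simp: M_def)
  also have "(\<Sum>m \<in> M. c m * mon m) =
      (\<Sum>m \<in> M. c m * (mon m - mon (rep (weight w m)))) + (\<Sum>m \<in> M. c m * mon (rep (weight w m)))"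
    by (simp add: algebra_simps flip: sum.distrib)
  also have "(\<Sum>m \<in> M. c m * mon (rep (weight w m))) =
      (\<Sum>n \<in> weight w ` M. \<Sum>m | m \<in> M \<and> weight w m = n. c m * mon (rep (weight w m)))"
    by (rule sum.image_gen[OF fin])
  also have "\<dots> = (\<Sum>n \<in> weight w ` M. (\<Sum>m | m \<in> M \<and> weight w m = n. c m) * mon (rep n))"
    by (simp add: sum_distrib_right)
  also have "\<dots> = 0" by (simp add: zero)
  finally have p_eq: "p = (\<Sum>m \<in> Poly_Mapping.keys p - M. c m * mon m) +
      (\<Sum>m \<in> M. c m * (mon m - mon (rep (weight w m))))" by simp
  have "(\<Sum>m \<in> Poly_Mapping.keys p - M. c m * mon m) \<in> I"
    using out by (intro mpoly_ideal_sum[OF I] mpoly_ideal_mult[OF I] c) (auto simp: M_def mon_def)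
  moreover have "(\<Sum>m \<in> M. c m * (mon m - mon (rep (weight w m)))) \<in> I"
    using eq rep by (intro mpoly_ideal_sum[OF I] mpoly_ideal_mult[OF I] c) (auto simp: M_def mon_def)
  ultimately show ?thesis by (subst p_eq) (rule mpoly_ideal_add[OF I])
qed

text \<open>
  Kronecker substitution: adding an index, scale the old weights by a base that exceeds all values
  at the new index, and give the new index weight \<open>1\<close>; the value there is then the last digit.
\<close>

lemma exists_separating_weight:
  fixes A :: "('i \<Rightarrow> nat) set"
  assumes "finite A" "finite S"
  obtains w where "\<And>g h. g \<in> A \<Longrightarrow> h \<in> A \<Longrightarrow> (\<Sum>i \<in> S. g i * w i) = (\<Sum>i \<in> S. h i * w i) \<Longrightarrow>
    \<forall>i \<in> S. g i = h i"
proof -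
  have "\<exists>w. \<forall>g \<in> A. \<forall>h \<in> A. (\<Sum>i \<in> S. g i * w i) = (\<Sum>i \<in> S. h i * w i) \<longrightarrow> (\<forall>i \<in> S. g i = h i)"
    using assms(2)
  proof (induction S)
    case (insert j S)
    then obtain w where w: "\<And>g h. g \<in> A \<Longrightarrow> h \<in> A \<Longrightarrow>
      (\<Sum>i \<in> S. g i * w i) = (\<Sum>i \<in> S. h i * w i) \<Longrightarrow> (\<forall>i \<in> S. g i = h i)" by metis
    define B where "B = Suc (Max (insert 0 ((\<lambda>g. g j) ` A)))"
    have B: "g j < B" if "g \<in> A" for g
      using that assms(1) by (simp add: B_def less_Suc_eq_le)
    define w' where "w' = (\<lambda>i. if i = j then 1 else B * w i)"
    have w': "(\<Sum>i \<in> insert j S. g i * w' i) = g j + B * (\<Sum>i \<in> S. g i * w i)" for g :: "'i \<Rightarrow> nat"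
    proof -
      have "(\<Sum>i \<in> S. g i * w' i) = (\<Sum>i \<in> S. B * (g i * w i))"
        using insert.hyps by (intro sum.cong) (auto simp: w'_def)
      then show ?thesis using insert.hyps by (simp add: w'_def sum_distrib_left)
    qed
    have "\<forall>i \<in> insert j S. g i = h i" if "g \<in> A" "h \<in> A"
      "(\<Sum>i \<in> insert j S. g i * w' i) = (\<Sum>i \<in> insert j S. h i * w' i)" for g h
    proof -
      have e: "g j + B * (\<Sum>i \<in> S. g i * w i) = h j + B * (\<Sum>i \<in> S. h i * w i)"
        using that(3) unfolding w' .
      have gh: "g j < B" "h j < B" using B that(1,2) by blast+
      from arg_cong[OF e, of "\<lambda>n. n mod B"] gh have j: "g j = h j" by simp
      with e gh have "(\<Sum>i \<in> S. g i * w i) = (\<Sum>i \<in> S. h i * w i)" by simp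
      with w[OF that(1,2)] j show ?thesis by blast
    qed
    then show ?case by blast
  qed auto
  then show ?thesis using that by blast
qed

section \<open>Monomials modulo the minors of a two-row matrix\<close>

lemma monomial_mem_ideal_if_divisible:
  assumes I: "ideal I (mpoly_ring V)" and ab: "Var a * Var b \<in> I" "a \<noteq> b"
    and m: "a \<in> Poly_Mapping.keys m" "b \<in> Poly_Mapping.keys m" "Poly_Mapping.keys m \<subseteq> V"
  shows "Poly_Mapping.single m 1 \<in> I"
proof -
  let ?e = "Poly_Mapping.single a 1 + Poly_Mapping.single b 1"
  obtain r where r: "m = r + ?e"
  proof
    show "m = (m - ?e) + ?e"
      using ab(2) m by (intro poly_mapping_eqI)
        (auto simp: lookup_add minus_poly_mapping.rep_eq lookup_single when_def in_keys_iff)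
  qed
  have "Poly_Mapping.keys r \<subseteq> V" using m(3) by (simp add: r keys_add_nat)
  then have "Poly_Mapping.single r 1 * (Var a * Var b) \<in> I"
    by (intro mpoly_ideal_mult[OF I ab(1)]) (simp add: mpoly_ring_carrier_iff)
  then show ?thesis by (simp add: r Var_def mult_single)
qed

text \<open>
  Read \<open>u i\<close> and \<open>v i\<close> as the entries of column \<open>i\<close> of a matrix with two rows. Two monomials that have
  the same degree in each row and in each column are congruent modulo the minors. Indeed, if they differ, then
  there are columns \<open>i\<close> and \<open>j\<close> such that \<open>m\<close> has more of \<open>u i\<close> and less of \<open>u j\<close> than \<open>m'\<close>; the
  column sums force \<open>v j\<close> to divide \<open>m\<close>, and the exchange of \<open>u i * v j\<close> for \<open>u j * v i\<close> brings \<open>m\<close>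
  nearer to \<open>m'\<close>.
\<close>

lemma monomials_congruent_mod_minors:
  fixes u v :: "'i \<Rightarrow> 'v" and m m' :: "'v \<Rightarrow>\<^sub>0 nat"
  assumes I: "ideal I (mpoly_ring V)"
    and minors: "\<And>i j. i \<in> S \<Longrightarrow> j \<in> S \<Longrightarrow> Var (u i) * Var (v j) - Var (u j) * Var (v i) \<in> I"
    and S: "finite S" "inj_on u S" "inj_on v S" "u ` S \<inter> v ` S = {}" "u ` S \<subseteq> V" "v ` S \<subseteq> V"
    and m: "Poly_Mapping.keys m \<subseteq> V"
    and row: "(\<Sum>i\<in>S. Poly_Mapping.lookup m (u i)) = (\<Sum>i\<in>S. Poly_Mapping.lookup m' (u i))"
    and col: "\<And>i. i \<in> S \<Longrightarrow> Poly_Mapping.lookup m (u i) + Poly_Mapping.lookup m (v i) =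
      Poly_Mapping.lookup m' (u i) + Poly_Mapping.lookup m' (v i)"
    and rest: "\<And>a. a \<notin> u ` S \<Longrightarrow> a \<notin> v ` S \<Longrightarrow> Poly_Mapping.lookup m a = Poly_Mapping.lookup m' a"
  shows "Poly_Mapping.single m 1 - Poly_Mapping.single m' 1 \<in> I"
  using m row col rest
proof (induction "\<Sum>i\<in>S. Poly_Mapping.lookup m (u i) - Poly_Mapping.lookup m' (u i)"
    arbitrary: m rule: less_induct)
  case less
  note row = less.prems(2) and col = less.prems(3) and rest = less.prems(4)
  show ?case
  proof (cases "\<forall>i\<in>S. Poly_Mapping.lookup m (u i) = Poly_Mapping.lookup m' (u i)")
    case True
    have "m = m'"
    proof (rule poly_mapping_eqI)
      fix a show "Poly_Mapping.lookup m a = Poly_Mapping.lookup m' a"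
        using True col rest[of a] by (cases "a \<in> u ` S \<or> a \<in> v ` S") auto
    qed
    then show ?thesis using mpoly_ideal_zero[OF I] by simp
  next
    case False
    obtain i where i: "i \<in> S" "Poly_Mapping.lookup m (u i) > Poly_Mapping.lookup m' (u i)"
    proof (rule ccontr)
      assume "\<not> thesis"
      then have le: "\<And>k. k \<in> S \<Longrightarrow> Poly_Mapping.lookup m (u k) \<le> Poly_Mapping.lookup m' (u k)"
        using that by fastforce
      with False obtain k where "k \<in> S" "Poly_Mapping.lookup m (u k) < Poly_Mapping.lookup m' (u k)"
        by (meson le_neq_implies_less)
      then have "(\<Sum>i\<in>S. Poly_Mapping.lookup m (u i)) < (\<Sum>i\<in>S. Poly_Mapping.lookup m' (u i))"
        using le S(1) by (intro sum_strict_mono_ex1) auto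
      with row show False by simp
    qed
    obtain j where j: "j \<in> S" "Poly_Mapping.lookup m (u j) < Poly_Mapping.lookup m' (u j)"
    proof (rule ccontr)
      assume "\<not> thesis"
      then have le: "\<And>k. k \<in> S \<Longrightarrow> Poly_Mapping.lookup m' (u k) \<le> Poly_Mapping.lookup m (u k)"
        using that by fastforce
      then have "(\<Sum>i\<in>S. Poly_Mapping.lookup m' (u i)) < (\<Sum>i\<in>S. Poly_Mapping.lookup m (u i))"
        using i S(1) by (intro sum_strict_mono_ex1) auto
      with row show False by simp
    qed
    have ij: "i \<noteq> j" using i j by auto
    have ne: "u i \<noteq> u j" "v i \<noteq> v j" "u i \<noteq> v j" "u j \<noteq> v i" "u i \<noteq> v i" "u j \<noteq> v j"
      using S ij i(1) j(1) by (auto dest: inj_onD)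
    have vj: "Poly_Mapping.lookup m (v j) > 0" using col[OF j(1)] j(2) by simp
    define r where "r = m - (Poly_Mapping.single (u i) 1 + Poly_Mapping.single (v j) 1)"
    have mr: "m = r + (Poly_Mapping.single (u i) 1 + Poly_Mapping.single (v j) 1)"
      using ne vj i(2) by (intro poly_mapping_eqI)
        (auto simp: r_def lookup_add minus_poly_mapping.rep_eq lookup_single when_def)
    define n where "n = r + (Poly_Mapping.single (u j) 1 + Poly_Mapping.single (v i) 1)"
    have m_eq: "Poly_Mapping.lookup m a =
      Poly_Mapping.lookup r a + (if a = u i then 1 else 0) + (if a = v j then 1 else 0)" for a
      by (subst mr) (auto simp: lookup_add lookup_single when_def)
    have n_eq: "Poly_Mapping.lookup n a =
      Poly_Mapping.lookup r a + (if a = u j then 1 else 0) + (if a = v i then 1 else 0)" for a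
      by (auto simp: n_def lookup_add lookup_single when_def)
    have uv_eq: "u k = u l \<longleftrightarrow> k = l" "v k = v l \<longleftrightarrow> k = l" "u k \<noteq> v l" "v k \<noteq> u l"
      if "k \<in> S" "l \<in> S" for k l
      using S that by (auto dest: inj_onD)
    have rV: "Poly_Mapping.keys r \<subseteq> V"
      using less.prems(1) by (subst (asm) mr) (simp add: keys_add_nat)
    have d: "Poly_Mapping.single r 1 * (Var (u i) * Var (v j) - Var (u j) * Var (v i)) \<in> I"
      by (intro mpoly_ideal_mult[OF I minors[OF i(1) j(1)]]) (simp add: mpoly_ring_carrier_iff rV)
    have d': "Poly_Mapping.single m 1 - Poly_Mapping.single n 1 \<in> I"
      using d by (subst mr) (simp add: n_def Var_def mult_single algebra_simps)
    have "Poly_Mapping.single n 1 - Poly_Mapping.single m' 1 \<in> I"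
    proof (rule less.hyps)
      show "(\<Sum>k\<in>S. Poly_Mapping.lookup n (u k) - Poly_Mapping.lookup m' (u k)) <
        (\<Sum>k\<in>S. Poly_Mapping.lookup m (u k) - Poly_Mapping.lookup m' (u k))"
      proof (rule sum_strict_mono_ex1[OF S(1)])
        show "\<forall>k\<in>S. Poly_Mapping.lookup n (u k) - Poly_Mapping.lookup m' (u k) \<le>
          Poly_Mapping.lookup m (u k) - Poly_Mapping.lookup m' (u k)"
          using i j uv_eq by (auto simp: m_eq n_eq)
        show "\<exists>k\<in>S. Poly_Mapping.lookup n (u k) - Poly_Mapping.lookup m' (u k) <
          Poly_Mapping.lookup m (u k) - Poly_Mapping.lookup m' (u k)"
          using i j uv_eq ij by (intro bexI[of _ i]) (auto simp: m_eq n_eq)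
      qed
      have "Poly_Mapping.keys n \<subseteq> Poly_Mapping.keys r \<union> {u j, v i}"
        by (simp add: n_def keys_add_nat) blast
      moreover have "u j \<in> V" "v i \<in> V"
        using S(5,6) i(1) j(1) by auto
      ultimately show "Poly_Mapping.keys n \<subseteq> V" using rV by blast
      have "(\<Sum>k\<in>S. Poly_Mapping.lookup n (u k)) = (\<Sum>k\<in>S. Poly_Mapping.lookup r (u k)) + 1"
        using S(1) i(1) j(1) uv_eq by (simp add: n_eq sum.distrib)
      also have "\<dots> = (\<Sum>k\<in>S. Poly_Mapping.lookup m (u k))"
        using S(1) i(1) j(1) uv_eq by (simp add: m_eq sum.distrib)
      finally show "(\<Sum>k\<in>S. Poly_Mapping.lookup n (u k)) = (\<Sum>k\<in>S. Poly_Mapping.lookup m' (u k))"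
        using row by simp
      fix k assume k: "k \<in> S"
      have "Poly_Mapping.lookup n (u k) + Poly_Mapping.lookup n (v k) =
        Poly_Mapping.lookup m (u k) + Poly_Mapping.lookup m (v k)"
        using i(1) j(1) k uv_eq by (auto simp: m_eq n_eq)
      then show "Poly_Mapping.lookup n (u k) + Poly_Mapping.lookup n (v k) =
        Poly_Mapping.lookup m' (u k) + Poly_Mapping.lookup m' (v k)"
        using col[OF k] by simp
    next
      fix a assume a: "a \<notin> u ` S" "a \<notin> v ` S"
      then have "a \<noteq> u i" "a \<noteq> u j" "a \<noteq> v i" "a \<noteq> v j" using i(1) j(1) by blast+
      then show "Poly_Mapping.lookup n a = Poly_Mapping.lookup m' a"
        using rest[OF a] by (simp add: m_eq n_eq)
    qed
    from mpoly_ideal_add[OF I d' this] show ?thesis by simp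
  qed
qed

text \<open>
  The curve that \<open>w\<close> describes lies on the variety of the minors, by the first conclusion. It is as
  general as possible: it separates the monomials of \<open>M\<close> that are not congruent modulo the minors.
  It arises from the parametrisation of matrices of rank one, with \<open>u i\<close> mapped to the product of
  \<open>v i\<close> and a new indeterminate.
\<close>

lemma exists_row_column_weight:
  fixes u v :: "'i \<Rightarrow> 'v" and M :: "('v \<Rightarrow>\<^sub>0 nat) set"
  assumes S: "finite S" "inj_on u S" "inj_on v S" "u ` S \<inter> v ` S = {}"
    and V: "finite V" "u ` S \<subseteq> V" "v ` S \<subseteq> V"
    and M: "finite M" "\<And>m. m \<in> M \<Longrightarrow> Poly_Mapping.keys m \<subseteq> V"
  obtains w where
    "\<And>i j. i \<in> S \<Longrightarrow> j \<in> S \<Longrightarrow> w (u i) + w (v j) = w (u j) + w (v i)"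
    "\<And>m m'. m \<in> M \<Longrightarrow> m' \<in> M \<Longrightarrow> weight w m = weight w m' \<Longrightarrow>
      (\<Sum>i\<in>S. Poly_Mapping.lookup m (u i)) = (\<Sum>i\<in>S. Poly_Mapping.lookup m' (u i)) \<and>
      (\<forall>i\<in>S. Poly_Mapping.lookup m (u i) + Poly_Mapping.lookup m (v i) =
        Poly_Mapping.lookup m' (u i) + Poly_Mapping.lookup m' (v i)) \<and>
      (\<forall>a. a \<notin> u ` S \<longrightarrow> a \<notin> v ` S \<longrightarrow> Poly_Mapping.lookup m a = Poly_Mapping.lookup m' a)"
proof -
  \<comment> \<open>\<open>g m\<close> is the exponent vector of the image of \<open>m\<close> under this parametrisation; \<open>None\<close> stands for
  the new indeterminate, whose exponent is the degree of \<open>m\<close> in the first row.\<close>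
  define g :: "('v \<Rightarrow>\<^sub>0 nat) \<Rightarrow> 'v option \<Rightarrow> nat" where
    "g m k = (case k of None \<Rightarrow> \<Sum>i\<in>S. Poly_Mapping.lookup m (u i)
      | Some a \<Rightarrow> Poly_Mapping.lookup m a + (\<Sum>i | i \<in> S \<and> v i = a. Poly_Mapping.lookup m (u i)))" for m k
  define K where "K = insert None (Some ` (V - u ` S))"
  have K: "finite K" using V by (simp add: K_def)
  obtain w0 where w0: "\<And>f h. f \<in> g ` M \<Longrightarrow> h \<in> g ` M \<Longrightarrow>
      (\<Sum>k\<in>K. f k * w0 k) = (\<Sum>k\<in>K. h k * w0 k) \<Longrightarrow> \<forall>k\<in>K. f k = h k"
    using exists_separating_weight[OF finite_imageI[OF M(1)] K, of g] by blast
  define w where "w a = (if a \<in> u ` S then w0 (Some (v (inv_into S u a))) + w0 None else w0 (Some a))" for a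
  have wu: "w (u i) = w0 (Some (v i)) + w0 None" if "i \<in> S" for i
    using that S by (simp add: w_def)
  have wv: "w (v i) = w0 (Some (v i))" if "i \<in> S" for i
    using that S(4) by (auto simp: w_def)
  have weight: "weight w m = (\<Sum>k\<in>K. g m k * w0 k)" if "m \<in> M" for m
  proof -
    let ?l = "Poly_Mapping.lookup m"
    have "weight w m = (\<Sum>a\<in>V. ?l a * w a)"
      using V(1) M(2)[OF that] by (rule weight_superset)
    also have "\<dots> = (\<Sum>a\<in>V - u ` S. ?l a * w a) + (\<Sum>a\<in>u ` S. ?l a * w a)"
      using V by (intro sum.subset_diff)
    also have "(\<Sum>a\<in>V - u ` S. ?l a * w a) = (\<Sum>a\<in>V - u ` S. ?l a * w0 (Some a))"
      by (intro sum.cong) (auto simp: w_def)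
    also have "(\<Sum>a\<in>u ` S. ?l a * w a) = (\<Sum>i\<in>S. ?l (u i) * w0 (Some (v i))) + (\<Sum>i\<in>S. ?l (u i)) * w0 None"
      using S(2) by (simp add: sum.reindex wu distrib_left sum.distrib sum_distrib_right)
    also have "(\<Sum>i\<in>S. ?l (u i) * w0 (Some (v i))) =
        (\<Sum>a\<in>V - u ` S. \<Sum>i | i \<in> S \<and> v i = a. ?l (u i) * w0 (Some (v i)))"
      using S V by (intro sum.group[symmetric]) auto
    also have "\<dots> = (\<Sum>a\<in>V - u ` S. (\<Sum>i | i \<in> S \<and> v i = a. ?l (u i)) * w0 (Some a))"
      by (simp add: sum_distrib_right)
    finally have "weight w m = (\<Sum>i\<in>S. ?l (u i)) * w0 None +
        (\<Sum>a\<in>V - u ` S. (?l a + (\<Sum>i | i \<in> S \<and> v i = a. ?l (u i))) * w0 (Some a))"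
      by (simp add: distrib_right sum.distrib)
    also have "\<dots> = (\<Sum>k\<in>K. g m k * w0 k)"
      using V(1) by (simp add: K_def g_def sum.reindex)
    finally show ?thesis .
  qed
  show ?thesis
  proof
    show "w (u i) + w (v j) = w (u j) + w (v i)" if "i \<in> S" "j \<in> S" for i j
      using that by (simp add: wu wv)
    fix m m' assume m: "m \<in> M" "m' \<in> M" "weight w m = weight w m'"
    then have eq: "\<forall>k\<in>K. g m k = g m' k"
      using w0[of "g m" "g m'"] by (simp add: weight)
    have "Poly_Mapping.lookup m (u i) + Poly_Mapping.lookup m (v i) =
        Poly_Mapping.lookup m' (u i) + Poly_Mapping.lookup m' (v i)" if i: "i \<in> S" for i
    proof -
      have "{k \<in> S. v k = v i} = {i}" using i S(3) by (auto dest: inj_onD)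
      moreover have "v i \<in> V - u ` S" using i V S(4) by blast
      with eq have "g m (Some (v i)) = g m' (Some (v i))" by (simp add: K_def)
      ultimately show ?thesis by (simp add: g_def)
    qed
    moreover have "Poly_Mapping.lookup m a = Poly_Mapping.lookup m' a"
      if a: "a \<notin> u ` S" "a \<notin> v ` S" for a
    proof (cases "a \<in> V")
      case True
      have "(\<Sum>i | i \<in> S \<and> v i = a. f i) = 0" for f :: "'i \<Rightarrow> nat"
        using a by (intro sum.neutral) auto
      moreover from True a eq have "g m (Some a) = g m' (Some a)" by (auto simp: K_def)
      ultimately show ?thesis by (simp add: g_def)
    next
      case False
      then show ?thesis using M(2)[OF m(1)] M(2)[OF m(2)] by (metis in_keys_iff subsetD)
    qed
    moreover have "g m None = g m' None" using eq by (simp add: K_def)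
    ultimately show "(\<Sum>i\<in>S. Poly_Mapping.lookup m (u i)) = (\<Sum>i\<in>S. Poly_Mapping.lookup m' (u i)) \<and>
      (\<forall>i\<in>S. Poly_Mapping.lookup m (u i) + Poly_Mapping.lookup m (v i) =
        Poly_Mapping.lookup m' (u i) + Poly_Mapping.lookup m' (v i)) \<and>
      (\<forall>a. a \<notin> u ` S \<longrightarrow> a \<notin> v ` S \<longrightarrow> Poly_Mapping.lookup m a = Poly_Mapping.lookup m' a)"
      by (simp add: g_def)
  qed
qed

section \<open>The ideals are radical\<close>

lemma matA_in_entries:
  assumes "r \<in> {1, 2}" "1 \<le> c" "c \<le> s + t"
  shows "matA s x y z r c \<in> entries s t x y z"
  using assms by (auto simp: entries_def positions_def intro!: image_eqI[of _ _ "(r, c)"])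

lemma xyz_in_entries:
  shows "1 \<le> i \<Longrightarrow> i \<le> s \<Longrightarrow> x i \<in> entries s t x y z"
    and "1 \<le> i \<Longrightarrow> i \<le> s \<Longrightarrow> x (s + i) \<in> entries s t x y z"
    and "i < t \<Longrightarrow> y i \<in> entries s t x y z"
    and "1 \<le> j \<Longrightarrow> j \<le> t \<Longrightarrow> z j \<in> entries s t x y z"
  using matA_in_entries[of 1 i s t x y z] matA_in_entries[of 2 i s t x y z]
    matA_in_entries[of 1 "s + i + 1" s t x y z] matA_in_entries[of 2 "s + j" s t x y z]
  by (auto simp: matA_def)

lemma finite_entries: "finite (entries s t x y z)"
  by (simp add: entries_def positions_def)

lemma J_gens_closed:
  "(J_gens s t x y z :: ('v, 'k::comm_ring_1) mpoly set) \<subseteq> carrier (mpoly_ring (entries s t x y z))"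
  by (auto simp: J_gens_def intro!: mpoly_ring_closed Var_closed matA_in_entries xyz_in_entries)

lemma J_ideal_ideal:
  "ideal (J_ideal s t x y z :: ('v, 'k::comm_ring_1) mpoly set) (mpoly_ring (entries s t x y z))"
  unfolding J_ideal_def using cring.axioms(1)[OF mpoly_ring_cring] J_gens_closed
  by (rule ring.genideal_ideal)

lemma J_gens_subset_J_ideal:
  "(J_gens s t x y z :: ('v, 'k::comm_ring_1) mpoly set) \<subseteq> J_ideal s t x y z"
  unfolding J_ideal_def using cring.axioms(1)[OF mpoly_ring_cring] J_gens_closed
  by (rule ring.genideal_self)

lemma curve_vanishes_on_J_ideal:
  fixes p :: "('v, 'k::comm_ring_1) mpoly"
  assumes p: "p \<in> J_ideal s t x y z"
    and minor: "\<And>i j. i \<in> {1..s} \<Longrightarrow> j \<in> {1..s} \<Longrightarrow>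
      x i \<in> W \<and> x (s + j) \<in> W \<longleftrightarrow> x j \<in> W \<and> x (s + i) \<in> W"
      "\<And>i j. i \<in> {1..s} \<Longrightarrow> j \<in> {1..s} \<Longrightarrow> x i \<in> W \<Longrightarrow> x (s + j) \<in> W \<Longrightarrow>
        w (x i) + w (x (s + j)) = w (x j) + w (x (s + i))"
    and xz: "\<And>i j. i \<in> {1..s} \<Longrightarrow> j \<in> {1..t} \<Longrightarrow> x i \<notin> W \<or> z j \<notin> W"
    and yz: "\<And>i j. i + 2 \<le> j \<Longrightarrow> j \<le> t \<Longrightarrow> y i \<notin> W \<or> z j \<notin> W"
  shows "curve w W p = 0"
proof (rule curve_vanishes_on_ideal[OF J_gens_closed])
  show "p \<in> Idl\<^bsub>mpoly_ring (entries s t x y z)\<^esub> (J_gens s t x y z)"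
    using p by (simp add: J_ideal_def)
next
  fix g :: "('v, 'k) mpoly" assume "g \<in> J_gens s t x y z"
  then consider (I) i j where "1 \<le> i" "i < j" "j \<le> s"
      "g = Var (matA s x y z 1 i) * Var (matA s x y z 2 j) - Var (matA s x y z 1 j) * Var (matA s x y z 2 i)"
    | (II) i j where "1 \<le> i" "i \<le> s" "1 \<le> j" "j \<le> t" "g = Var (x i) * Var (z j)"
    | (III) i j where "i + 2 \<le> j" "j \<le> t" "g = Var (y i) * Var (z j)"
    unfolding J_gens_def by blast
  then show "curve w W g = 0"
  proof cases
    case I
    then have ij: "i \<in> {1..s}" "j \<in> {1..s}"
      and g: "g = Var (x i) * Var (x (s + j)) - Var (x j) * Var (x (s + i))"
      by (simp_all add: matA_def)
    show ?thesis
      using minor[OF ij] by (auto simp: g curve_diff curve_mult curve_Var mult_monom)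
  next
    case II
    with xz[of i j] show ?thesis by (auto simp: curve_mult curve_Var)
  next
    case III
    with yz[of i j] show ?thesis by (auto simp: curve_mult curve_Var)
  qed
qed

text \<open>
  The generators are the minors with \<open>i < j\<close>; the other cases are trivial or differ by a sign.
\<close>

lemma J_ideal_minor:
  assumes i: "i \<in> {1..s}" and j: "j \<in> {1..s}"
  shows "(Var (x i) * Var (x (s + j)) - Var (x j) * Var (x (s + i)) :: ('v, 'k::comm_ring_1) mpoly)
    \<in> J_ideal s t x y z"
proof -
  have gen: "Var (x i) * Var (x (s + j)) - Var (x j) * Var (x (s + i)) \<in>
      (J_gens s t x y z :: ('v, 'k) mpoly set)" if "1 \<le> i" "i < j" "j \<le> s" for i j
  proof -
    have "Var (x i) * Var (x (s + j)) - Var (x j) * Var (x (s + i)) =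
        (Var (matA s x y z 1 i) * Var (matA s x y z 2 j)
          - Var (matA s x y z 1 j) * Var (matA s x y z 2 i) :: ('v, 'k) mpoly)"
      using that by (simp add: matA_def)
    then show ?thesis unfolding J_gens_def using that by blast
  qed
  note 0 = mpoly_ideal_zero[OF J_ideal_ideal]
  consider "i < j" | "i = j" | "j < i" by linarith
  then show ?thesis
  proof cases
    case 1
    then show ?thesis using gen[of i j] i j J_gens_subset_J_ideal
      unfolding atLeastAtMost_iff by blast
  next
    case 2
    then show ?thesis using 0 by simp
  next
    case 3
    then have "Var (x j) * Var (x (s + i)) - Var (x i) * Var (x (s + j)) \<in>
      (J_ideal s t x y z :: ('v, 'k) mpoly set)"
      using gen[of j i] i j J_gens_subset_J_ideal unfolding atLeastAtMost_iff by blast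
    from mpoly_ideal_diff[OF J_ideal_ideal 0 this] show ?thesis by simp
  qed
qed

text \<open>
  The permitted coincidences of entries never affect the two factors of a generator, so the generators
  of types (II) and (III) are squarefree monomials. In the last case, \<open>z j = y i\<close> would require \<open>j \<le> i\<close>.
\<close>

lemma admissible_distinct:
  assumes "admissible s t x y z"
  shows "inj_on x {1..2 * s}"
    and "\<And>i j. i \<in> {1..2 * s} \<Longrightarrow> j \<in> {1..t} \<Longrightarrow> x i \<noteq> z j"
    and "\<And>i j. i + 2 \<le> j \<Longrightarrow> j \<le> t \<Longrightarrow> y i \<noteq> z j"
proof -
  have adm: "\<forall>i \<in> {1..t}. \<forall>j \<in> {0..t - 1}. z i = y j \<longrightarrow> i \<le> j"
    "\<forall>i \<in> {1..2 * s}. \<forall>j \<in> {1..t}. x i \<noteq> z j" "inj_on x {1..2 * s}"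
    by (insert assms, unfold admissible_def, (elim conjE, assumption)+)
  show "inj_on x {1..2 * s}" by (rule adm)
  show "x i \<noteq> z j" if "i \<in> {1..2 * s}" "j \<in> {1..t}" for i j using adm(2) that by blast
  show "y i \<noteq> z j" if "i + 2 \<le> j" "j \<le> t" for i j
  proof
    assume "y i = z j"
    moreover have "j \<in> {1..t}" "i \<in> {0..t - 1}" using that by auto
    ultimately have "j \<le> i" using adm(1) by metis
    with that(1) show False by simp
  qed
qed

lemma monomial_mem_J_ideal:
  assumes adm: "admissible s t x y z"
    and m: "Poly_Mapping.keys m \<subseteq> entries s t x y z"
      "j \<in> {1..t}" "z j \<in> Poly_Mapping.keys m"
    and div: "(\<exists>i\<in>{1..s}. x i \<in> Poly_Mapping.keys m) \<or>
      (\<exists>i j. i + 2 \<le> j \<and> j \<le> t \<and> y i \<in> Poly_Mapping.keys m \<and> z j \<in> Poly_Mapping.keys m)"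
  shows "(Poly_Mapping.single m 1 :: ('v, 'k::comm_ring_1) mpoly) \<in> J_ideal s t x y z"
  using div
proof (elim disjE bexE exE conjE)
  fix i assume i: "i \<in> {1..s}" "x i \<in> Poly_Mapping.keys m"
  have "Var (x i) * Var (z j) \<in> (J_gens s t x y z :: ('v, 'k) mpoly set)"
    unfolding J_gens_def
    by (rule UnI1, rule UnI2, rule CollectI, rule exI[of _ i], rule exI[of _ j])
      (use i m(2) in simp)
  then have "Var (x i) * Var (z j) \<in> (J_ideal s t x y z :: ('v, 'k) mpoly set)"
    using J_gens_subset_J_ideal by (rule rev_subsetD)
  moreover have "x i \<noteq> z j" using admissible_distinct(2)[OF adm] i(1) m(2) by simp
  ultimately show ?thesis
    by (rule monomial_mem_ideal_if_divisible[OF J_ideal_ideal _ _ i(2) m(3) m(1)])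
next
  fix i j assume ij: "i + 2 \<le> j" "j \<le> t" "y i \<in> Poly_Mapping.keys m" "z j \<in> Poly_Mapping.keys m"
  have "Var (y i) * Var (z j) \<in> (J_gens s t x y z :: ('v, 'k) mpoly set)"
    unfolding J_gens_def
    by (rule UnI2, rule CollectI, rule exI[of _ i], rule exI[of _ j]) (use ij(1,2) in simp)
  then have "Var (y i) * Var (z j) \<in> (J_ideal s t x y z :: ('v, 'k) mpoly set)"
    using J_gens_subset_J_ideal by (rule rev_subsetD)
  moreover have "y i \<noteq> z j" using admissible_distinct(3)[OF adm] ij(1,2) .
  ultimately show ?thesis
    by (rule monomial_mem_ideal_if_divisible[OF J_ideal_ideal _ _ ij(3,4) m(1)])
qed

text \<open>
  The variety of \<open>J\<close> is the union of two parts: on one all \<open>z j\<close> vanish, along with the minors; on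
  the other \<open>x 1, \<dots>, x s\<close> vanish, along with the products of type (III), so that it is a union of
  coordinate subspaces. Let a power of \<open>p\<close> be in \<open>J\<close>. Then \<open>p\<close> vanishes on every monomial curve in
  either part. From the curves in the second part it follows that each monomial of \<open>p\<close> is divisible
  by one of \<open>x 1, \<dots>, x s\<close> or by a product of type (III). Hence the monomials with a factor \<open>z j\<close> are in \<open>J\<close>, and a
  suitable curve in the first part takes care of the others.
\<close>

lemma J_ideal_radical:
  fixes p :: "('v, 'k::idom) mpoly"
  assumes adm: "admissible s t x y z"
    and p: "p \<in> carrier (mpoly_ring (entries s t x y z))" and pn: "p ^ n \<in> J_ideal s t x y z"
  shows "p \<in> J_ideal s t x y z"
proof -
  define M where "M = Poly_Mapping.keys p"
  define V where "V = entries s t x y z"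
  have M: "finite M" "\<And>m. m \<in> M \<Longrightarrow> Poly_Mapping.keys m \<subseteq> V"
    using p by (auto simp: M_def V_def mpoly_ring_carrier_iff)
  have V: "finite V" by (simp add: V_def finite_entries)
  note xz = admissible_distinct(2)[OF adm]
  have div: "(\<exists>i\<in>{1..s}. x i \<in> Poly_Mapping.keys m) \<or>
      (\<exists>i j. i + 2 \<le> j \<and> j \<le> t \<and> y i \<in> Poly_Mapping.keys m \<and> z j \<in> Poly_Mapping.keys m)"
    if m: "m \<in> M" for m
  proof (rule ccontr)
    assume neg: "\<not> ?thesis"
    \<comment> \<open>Otherwise the coordinate subspace of the indeterminates of \<open>m\<close> lies in the second part,
    and the coefficient of \<open>m\<close> can be read off on a curve in it.\<close>
    obtain w where w: "\<And>f h. f \<in> Poly_Mapping.lookup ` M \<Longrightarrow> h \<in> Poly_Mapping.lookup ` M \<Longrightarrow>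
      (\<Sum>i\<in>V. f i * w i) = (\<Sum>i\<in>V. h i * w i) \<Longrightarrow> \<forall>i\<in>V. f i = h i"
      using exists_separating_weight[OF finite_imageI[OF M(1)] V, of Poly_Mapping.lookup] by blast
    have inj: "a = b" if "a \<in> M" "b \<in> M" "weight w a = weight w b" for a b
    proof (rule poly_mapping_eqI)
      fix v
      have "\<forall>v\<in>V. Poly_Mapping.lookup a v = Poly_Mapping.lookup b v"
        using that M V by (intro w) (auto simp: weight_superset)
      moreover have "Poly_Mapping.lookup a v = Poly_Mapping.lookup b v" if "v \<notin> V"
        using M(2)[OF \<open>a \<in> M\<close>] M(2)[OF \<open>b \<in> M\<close>] that by (metis in_keys_iff subsetD)
      ultimately show "Poly_Mapping.lookup a v = Poly_Mapping.lookup b v" by blast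
    qed
    have "curve w (Poly_Mapping.keys m) (p ^ n) = 0"
      by (rule curve_vanishes_on_J_ideal[OF pn]) (use neg in auto)
    then have 0: "curve w (Poly_Mapping.keys m) p = 0" by (rule curve_vanishes_if_power)
    have "{a. a \<in> M \<and> Poly_Mapping.keys a \<subseteq> Poly_Mapping.keys m \<and> weight w a = weight w m} = {m}"
      using m inj by auto
    then have "coeff (curve w (Poly_Mapping.keys m) p) (weight w m) = Poly_Mapping.lookup p m"
      by (simp add: coeff_curve flip: M_def)
    then show False using 0 m by (simp add: M_def in_keys_iff)
  qed
  note x = admissible_distinct(1)[OF adm]
  have "inj_on (x \<circ> (+) s) {1..s}"
    by (intro comp_inj_on inj_on_subset[OF x]) auto
  moreover have "x i \<noteq> x (s + j)" if "i \<in> {1..s}" "j \<in> {1..s}" for i j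
    using inj_onD[OF x, of i "s + j"] that by auto
  then have "x ` {1..s} \<inter> (\<lambda>i. x (s + i)) ` {1..s} = {}" by blast
  moreover have "inj_on x {1..s}" by (rule inj_on_subset[OF x]) auto
  ultimately have S: "finite {1..s}" "inj_on x {1..s}" "inj_on (\<lambda>i. x (s + i)) {1..s}"
    "x ` {1..s} \<inter> (\<lambda>i. x (s + i)) ` {1..s} = {}"
    by (simp_all add: comp_def)
  have uvV: "x ` {1..s} \<subseteq> V" "(\<lambda>i. x (s + i)) ` {1..s} \<subseteq> V"
    using xyz_in_entries[where x = x and y = y and z = z and s = s and t = t] by (auto simp: V_def)
  obtain w where w: "\<And>i j. i \<in> {1..s} \<Longrightarrow> j \<in> {1..s} \<Longrightarrow>
      w (x i) + w (x (s + j)) = w (x j) + w (x (s + i))"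
    and inj: "\<And>m m'. m \<in> M \<Longrightarrow> m' \<in> M \<Longrightarrow> weight w m = weight w m' \<Longrightarrow>
      (\<Sum>i\<in>{1..s}. Poly_Mapping.lookup m (x i)) = (\<Sum>i\<in>{1..s}. Poly_Mapping.lookup m' (x i)) \<and>
      (\<forall>i\<in>{1..s}. Poly_Mapping.lookup m (x i) + Poly_Mapping.lookup m (x (s + i)) =
        Poly_Mapping.lookup m' (x i) + Poly_Mapping.lookup m' (x (s + i))) \<and>
      (\<forall>a. a \<notin> x ` {1..s} \<longrightarrow> a \<notin> (\<lambda>i. x (s + i)) ` {1..s} \<longrightarrow>
        Poly_Mapping.lookup m a = Poly_Mapping.lookup m' a)"
    using exists_row_column_weight[OF S V uvV M] by blast
  \<comment> \<open>The curve in the first part: the weights satisfy the minors and all \<open>z j\<close> are replaced by \<open>0\<close>.\<close>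
  define W where "W = V - z ` {1..t}"
  have xW: "x i \<in> W" "x (s + i) \<in> W" if "i \<in> {1..s}" for i
    using that uvV xz by (auto simp: W_def)
  show ?thesis
  proof (rule mem_ideal_if_curve_vanishes[OF J_ideal_ideal p])
    have "curve w W (p ^ n) = 0"
    proof (rule curve_vanishes_on_J_ideal[OF pn])
      show "x i \<in> W \<and> x (s + j) \<in> W \<longleftrightarrow> x j \<in> W \<and> x (s + i) \<in> W"
        if "i \<in> {1..s}" "j \<in> {1..s}" for i j using xW that by blast
    qed (use w in \<open>auto simp: W_def\<close>)
    then show "curve w W p = 0" by (rule curve_vanishes_if_power)
  next
    fix m assume m: "m \<in> Poly_Mapping.keys p" "\<not> Poly_Mapping.keys m \<subseteq> W"
    then have mM: "m \<in> M" by (simp add: M_def)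
    with m M(2)[OF mM] obtain j where "j \<in> {1..t}" "z j \<in> Poly_Mapping.keys m"
      unfolding W_def by blast
    with adm M(2)[OF mM] div[OF mM] show "Poly_Mapping.single m 1 \<in> J_ideal s t x y z"
      unfolding V_def by (intro monomial_mem_J_ideal)
  next
    fix m m' assume "m \<in> Poly_Mapping.keys p" "m' \<in> Poly_Mapping.keys p" "weight w m = weight w m'"
    then have m: "m \<in> M" and "m' \<in> M" by (simp_all add: M_def)
    note eq = inj[OF this \<open>weight w m = weight w m'\<close>]
    show "Poly_Mapping.single m 1 - Poly_Mapping.single m' 1 \<in> J_ideal s t x y z"
    proof (rule monomials_congruent_mod_minors[OF J_ideal_ideal J_ideal_minor S uvV[unfolded V_def]
            M(2)[OF m, unfolded V_def] eq[THEN conjunct1]])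
      show "Poly_Mapping.lookup m (x i) + Poly_Mapping.lookup m (x (s + i)) =
          Poly_Mapping.lookup m' (x i) + Poly_Mapping.lookup m' (x (s + i))"
        if "i \<in> {1..s}" for i using eq that by blast
      show "Poly_Mapping.lookup m a = Poly_Mapping.lookup m' a"
        if "a \<notin> x ` {1..s}" "a \<notin> (\<lambda>i. x (s + i)) ` {1..s}" for a using eq that by blast
    qed
  qed
qed

section \<open>The bound on the arithmetical rank\<close>

text \<open>
  Column \<open>b\<close> is one of the last \<open>t\<close> columns in the second case, and the product is the diagonal term
  of the minor of columns \<open>a\<close> and \<open>b\<close>. This treats the products with \<open>x\<close> and those with \<open>y\<close> alike.
\<close>

definition generator :: "nat \<Rightarrow> (nat \<Rightarrow> nat \<Rightarrow> 'v) \<Rightarrow> nat \<times> nat \<Rightarrow> ('v, 'k::comm_ring_1) mpoly" where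
  "generator s A = (\<lambda>(a, b). if b \<le> s then Var (A 1 a) * Var (A 2 b) - Var (A 1 b) * Var (A 2 a)
     else Var (A 1 a) * Var (A 2 b))"

text \<open>
  The minors are ordered by the sum of their columns, as for the generic matrix, and the products by
  the distance of their columns, the farthest apart first. The shift \<open>t - 1\<close> makes minors and products
  share the levels from \<open>t + 2\<close> to \<open>s + t - 1\<close>, and it is as small as the mixed case of
  \<open>generator_products_lower_level\<close> permits.
\<close>

definition level :: "nat \<Rightarrow> nat \<Rightarrow> nat \<times> nat \<Rightarrow> nat" where
  "level s t = (\<lambda>(a, b). if b \<le> s then a + b + t - 1 else a + (s + t) - b)"

definition column_pairs :: "nat \<Rightarrow> (nat \<times> nat) set" where
  "column_pairs n = {(a, b). 1 \<le> a \<and> a < b \<and> b \<le> n}"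

lemma finite_column_pairs: "finite (column_pairs n)"
  by (rule finite_subset[of _ "{..n} \<times> {..n}"]) (auto simp: column_pairs_def)

lemma J_gens_eq_generators:
  "(J_gens s t x y z :: ('v, 'k::comm_ring_1) mpoly set) =
    generator s (matA s x y z) ` column_pairs (s + t)" (is "?J = ?G")
proof (intro equalityI subsetI)
  let ?g = "generator s (matA s x y z) :: nat \<times> nat \<Rightarrow> ('v, 'k) mpoly"
  fix g assume "g \<in> ?J"
  then consider (I) i j where "1 \<le> i" "i < j" "j \<le> s"
      "g = Var (matA s x y z 1 i) * Var (matA s x y z 2 j) - Var (matA s x y z 1 j) * Var (matA s x y z 2 i)"
    | (II) i j where "1 \<le> i" "i \<le> s" "1 \<le> j" "j \<le> t" "g = Var (x i) * Var (z j)"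
    | (III) i j where "i + 2 \<le> j" "j \<le> t" "g = Var (y i) * Var (z j)"
    unfolding J_gens_def by blast
  then show "g \<in> ?G"
  proof cases
    case I
    then have "g = ?g (i, j)" "(i, j) \<in> column_pairs (s + t)"
      by (auto simp: generator_def column_pairs_def)
    then show ?thesis by blast
  next
    case II
    then have "g = ?g (i, s + j)" "(i, s + j) \<in> column_pairs (s + t)"
      by (auto simp: generator_def column_pairs_def matA_def)
    then show ?thesis by blast
  next
    case III
    then have "g = ?g (s + i + 1, s + j)" "(s + i + 1, s + j) \<in> column_pairs (s + t)"
      by (auto simp: generator_def column_pairs_def matA_def)
    then show ?thesis by blast
  qed
next
  fix g assume "g \<in> ?G"
  then obtain a b where ab: "1 \<le> a" "a < b" "b \<le> s + t" "g = generator s (matA s x y z) (a, b)"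
    by (auto simp: column_pairs_def)
  consider "b \<le> s" | "a \<le> s" "s < b" | "s < a" by linarith
  then show "g \<in> ?J"
  proof cases
    case 1
    then have "g = Var (matA s x y z 1 a) * Var (matA s x y z 2 b)
        - Var (matA s x y z 1 b) * Var (matA s x y z 2 a)"
      using ab(4) by (simp add: generator_def)
    then show ?thesis using ab(1,2) 1 unfolding J_gens_def by blast
  next
    case 2
    then have "g = Var (x a) * Var (z (b - s))" "1 \<le> b - s" "b - s \<le> t"
      using ab by (auto simp: generator_def matA_def)
    then show ?thesis using ab(1) 2(1) unfolding J_gens_def by blast
  next
    case 3
    then have "g = Var (y (a - s - 1)) * Var (z (b - s))" "a - s - 1 + 2 \<le> b - s" "b - s \<le> t"
      using ab by (auto simp: generator_def matA_def)
    then show ?thesis unfolding J_gens_def by blast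
  qed
qed

lemma level_range:
  assumes "1 \<le> s" "p \<in> column_pairs (s + t)"
  shows "level s t p \<in> {1..2 * s + t - 2}"
  using assms by (auto simp: level_def column_pairs_def split: if_splits)

text \<open>
  For two minors of equal column sum, one pair of columns is nested in the other, and the Pluecker
  relation expresses the product by minors of smaller sum. For two products of equal distance,
  combine the smaller first column with the larger second one. For a minor of columns \<open>a < b\<close> and a
  product of columns \<open>c < d\<close>, equality of the levels means \<open>c = a + b - 1 + (d - s)\<close>, hence \<open>b < c\<close>, and
  both \<open>(a, d)\<close> and \<open>(b, d)\<close> are farther apart than \<open>(c, d)\<close>.
\<close>

lemma generator_products_lower_level:
  fixes s t :: nat and A :: "nat \<Rightarrow> nat \<Rightarrow> 'v" and V :: "'v set"
  defines "g \<equiv> generator s A :: nat \<times> nat \<Rightarrow> ('v, 'k::comm_ring_1) mpoly"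
  assumes A: "\<And>r c. r \<in> {1, 2} \<Longrightarrow> 1 \<le> c \<Longrightarrow> c \<le> s + t \<Longrightarrow> A r c \<in> V"
    and p: "p \<in> column_pairs (s + t)" and q: "q \<in> column_pairs (s + t)"
    and pq: "p \<noteq> q" "level s t p = level s t q"
    and I: "ideal I (mpoly_ring V)"
    and low: "\<And>i. i \<in> column_pairs (s + t) \<Longrightarrow> level s t i < level s t p \<Longrightarrow> g i \<in> I"
  shows "g p * g q \<in> I"
proof -
  define U :: "nat \<Rightarrow> ('v, 'k) mpoly" where "U c = Var (A 1 c)" for c
  define W :: "nat \<Rightarrow> ('v, 'k) mpoly" where "W c = Var (A 2 c)" for c
  have UW: "U c \<in> carrier (mpoly_ring V)" "W c \<in> carrier (mpoly_ring V)"
    if "1 \<le> c" "c \<le> s + t" for c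
    using A that by (auto simp: U_def W_def intro: Var_closed)
  note cl = mpoly_ideal_add[OF I] mpoly_ideal_diff[OF I] mpoly_ideal_mult[OF I]
  have minor: "g (a, b) = U a * W b - U b * W a" if "b \<le> s" for a b
    using that by (simp add: g_def generator_def U_def W_def)
  have prod: "g (a, b) = U a * W b" if "s < b" for a b
    using that by (simp add: g_def generator_def U_def W_def)
  \<comment> \<open>Up to exchanging \<open>p\<close> and \<open>q\<close>, a minor comes before a product and the first columns increase.\<close>
  have main: "g (a, b) * g (c, d) \<in> I"
    if ab: "(a, b) \<in> column_pairs (s + t)" and cd: "(c, d) \<in> column_pairs (s + t)"
      and lev: "level s t (a, b) = level s t p" "level s t (c, d) = level s t p"
      and ord: "b \<le> s \<and> s < d \<or> (b \<le> s \<longleftrightarrow> d \<le> s) \<and> a < c" for a b c d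
  proof -
    have ab': "1 \<le> a" "a < b" "b \<le> s + t" and cd': "1 \<le> c" "c < d" "d \<le> s + t"
      using ab cd by (auto simp: column_pairs_def)
    have low: "g (i, j) \<in> I"
      if "1 \<le> i" "i < j" "j \<le> s + t" "level s t (i, j) < level s t (a, b)" for i j
      using low[of "(i, j)"] that lev by (simp add: column_pairs_def)
    have lev': "level s t (a, b) = level s t (c, d)" using lev by simp
    consider (minors) "b \<le> s" "d \<le> s" "a < c" | (mixed) "b \<le> s" "s < d" | (prods) "s < b" "s < d" "a < c"
      using ord by linarith
    then show ?thesis
    proof cases
      case minors
      have "d < b" using lev' minors ab' cd' by (simp add: level_def)
      have I': "g (a, c) \<in> I" "g (a, d) \<in> I"
        using \<open>d < b\<close> minors ab' cd' unfolding lev' by (auto intro!: low simp: lev' level_def)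
      have eq: "g (a, b) * g (c, d) = g (c, b) * g (a, d) - g (d, b) * g (a, c)"
        using minors cd'(2) by (simp add: minor algebra_simps)
      show ?thesis unfolding eq
        using ab' cd' minors unfolding minor[OF minors(1)]
        by (intro cl I' mpoly_ring_closed UW) auto
    next
      case mixed
      have "b < c" using lev' mixed ab' cd' by (simp add: level_def)
      then have I': "g (a, d) \<in> I" "g (b, d) \<in> I"
        using mixed ab' cd' unfolding lev' by (auto intro!: low simp: lev' level_def)
      have eq: "g (a, b) * g (c, d) = (U c * W b) * g (a, d) - (U c * W a) * g (b, d)"
        using mixed by (simp add: minor prod algebra_simps)
      show ?thesis unfolding eq
        using ab' cd' mixed by (intro cl I' mpoly_ring_closed UW) auto
    next
      case prods
      have "b < d" using lev' prods ab' cd' by (simp add: level_def)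
      then have I': "g (a, d) \<in> I" using prods ab' cd' by (intro low) (auto simp: level_def)
      have eq: "g (a, b) * g (c, d) = (U c * W b) * g (a, d)"
        using prods by (simp add: prod algebra_simps)
      show ?thesis unfolding eq
        using ab' cd' by (intro cl I' mpoly_ring_closed UW) auto
    qed
  qed
  obtain a b c d where pq_eq: "p = (a, b)" "q = (c, d)" by (metis surj_pair)
  have "a \<noteq> c \<or> b \<le> s \<and> s < d \<or> d \<le> s \<and> s < b"
    using pq p q unfolding pq_eq by (auto simp: level_def column_pairs_def split: if_splits)
  then consider "b \<le> s \<and> s < d \<or> (b \<le> s \<longleftrightarrow> d \<le> s) \<and> a < c"
    | "d \<le> s \<and> s < b \<or> (d \<le> s \<longleftrightarrow> b \<le> s) \<and> c < a"
    by linarith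
  then show ?thesis
  proof cases
    case 1
    then show ?thesis by (intro main[of a b c d, folded pq_eq] p q pq(2)[symmetric] refl)
  next
    case 2
    then show ?thesis by (subst mult.commute) (intro main[of c d a b, folded pq_eq] p q pq(2)[symmetric] refl)
  qed
qed

theorem theorem4:
  fixes s t :: nat and x y z :: "nat \<Rightarrow> 'v"
  assumes "s \<ge> 2" and "t \<ge> 1" and "admissible s t x y z"
  shows "ara (mpoly_ring (entries s t x y z))
             (J_ideal s t x y z :: ('v, 'k::alg_closed_field) mpoly set) \<le> enat (2 * s + t - 2)"
proof -
  define R :: "('v, 'k) mpoly ring" where "R = mpoly_ring (entries s t x y z)"
  define P where "P = column_pairs (s + t)"
  define g :: "nat \<times> nat \<Rightarrow> ('v, 'k) mpoly" where "g = generator s (matA s x y z)"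
  define J :: "('v, 'k) mpoly set" where "J = J_ideal s t x y z"
  define F where "F l = (\<Sum>p | p \<in> P \<and> level s t p = l. g p)" for l
  let ?L = "{1..2 * s + t - 2}"
  interpret cring R unfolding R_def by (rule mpoly_ring_cring)
  have gens: "J_gens s t x y z = g ` P" unfolding g_def P_def by (rule J_gens_eq_generators)
  have gR: "g ` P \<subseteq> carrier R" unfolding gens[symmetric] R_def by (rule J_gens_closed)
  have J: "ideal J R" unfolding J_def R_def by (rule J_ideal_ideal)
  have FJ: "F ` ?L \<subseteq> J"
    using J_gens_subset_J_ideal[of s t x y z, where ?'k = 'k] unfolding gens J_def[symmetric]
    by (auto simp: F_def intro!: mpoly_ideal_sum[OF J[unfolded R_def]])
  then have FR: "F ` ?L \<subseteq> carrier R" using mpoly_ideal_carrier[OF J[unfolded R_def]] R_def by blast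
  have "J = radical_ideal R (Idl\<^bsub>R\<^esub> (F ` ?L))"
  proof
    have "g ` P \<subseteq> radical_ideal R (Idl\<^bsub>R\<^esub> (F ` ?L))"
      unfolding F_def R_def
    proof (rule schmitt_vogel)
      show "finite P" by (simp add: P_def finite_column_pairs)
      show "g ` P \<subseteq> carrier (mpoly_ring (entries s t x y z))" using gR by (simp add: R_def)
      show "level s t ` P \<subseteq> ?L" using assms(1) level_range by (force simp: P_def)
      fix p q assume pq: "p \<in> P" "q \<in> P" "p \<noteq> q" "level s t p = level s t q"
      let ?low = "g ` {i \<in> P. level s t i < level s t p}"
      have low: "?low \<subseteq> carrier R" using gR by blast
      show "g p * g q \<in> Idl\<^bsub>mpoly_ring (entries s t x y z)\<^esub> ?low"
        unfolding R_def[symmetric]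
      proof (rule generator_products_lower_level[of s t "matA s x y z" "entries s t x y z" p q
            "Idl\<^bsub>R\<^esub> ?low", folded g_def R_def P_def])
        show "ideal (Idl\<^bsub>R\<^esub> ?low) R" by (rule genideal_ideal[OF low])
        show "g i \<in> Idl\<^bsub>R\<^esub> ?low" if "i \<in> P" "level s t i < level s t p" for i
          using genideal_self[OF low] that by blast
        show "matA s x y z r c \<in> entries s t x y z" if "r \<in> {1, 2}" "1 \<le> c" "c \<le> s + t" for r c
          using that by (rule matA_in_entries)
      qed (use pq in auto)
    qed
    then have "Idl\<^bsub>R\<^esub> (g ` P) \<subseteq> radical_ideal R (Idl\<^bsub>R\<^esub> (F ` ?L))"
      using genideal_ideal[OF FR] unfolding R_def
      by (intro ring.genideal_minimal ideal_radical_ideal cring.axioms(1)[OF mpoly_ring_cring])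
    then show "J \<subseteq> radical_ideal R (Idl\<^bsub>R\<^esub> (F ` ?L))"
      by (simp only: J_def J_ideal_def gens R_def)
    have "Idl\<^bsub>R\<^esub> (F ` ?L) \<subseteq> J" by (rule genideal_minimal[OF J FJ])
    then show "radical_ideal R (Idl\<^bsub>R\<^esub> (F ` ?L)) \<subseteq> J"
      using J_ideal_radical[OF assms(3)] by (auto simp: radical_ideal_def R_def J_def)
  qed
  then have "ara R J \<le> enat (2 * s + t - 2)"
    unfolding ara_def using FR by (intro INF_lower) blast
  then show ?thesis by (simp only: R_def J_def)
qed

end
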